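(* Let $n\ge 4$, let $\mathbb{K}$ be a non-Archimedean local skew field of characteristic zero, and let $\mathcal{X}$ be the ($1$-skeleton of the) Bruhat–Tits building of $PSL_n(\mathbb{K})$. For a vertex $x$ of $\mathcal{X}$ let $\mathcal{P}(x)=B_{\mathcal{X}}(x,1)\cap\tau^{-1}(0)$ be its print. Let $x_1,x_2$ be vertices of $\mathcal{X}$. If $\mathcal{P}(x_1)=\mathcal{P}(x_2)$, then $x_1=x_2$.
   Context: A non-Archimedean local skew field is a field $\mathbb{K}$ (not necessarily commutative) endowed with a discrete valuation, i.e. a surjective homomorphism $v:\mathbb{K}^*\to\mathbb{Z}$ with $v(x+y)\ge\min\{v(x),v(y)\}$ whenever $x+y\ne 0$ (and $v(0)=+\infty$), such that $\mathbb{K}$ is locally compact for the topology associated to $v$. Put $\mathcal{O}=\{x\in\mathbb{K}: v(x)\ge 0\}$ and let $\pi$ be a generator of $\{x: v(x)>0\}$. An $\mathcal{O}$-lattice of $\mathbb{K}^n$ is an $\mathcal{O}$-submodule of the form $\mathcal{O}e_1+\dots+\mathcal{O}e_n$ with $(e_1,\dots,e_n)$ a basis of $\mathbb{K}^n$; lattices $L$ and $aL$ ($a\in\mathbb{K}^*$) are homothetic and $[L]$ is the homothety class. The graph $\mathcal{X}$ has as vertices the homothety classes of $\mathcal{O}$-lattices; two distinct vertices are joined by an edge if they have representatives $L_1,L_2$ with $\pi L_1\subset L_2\subset L_1$. It carries the graph metric with edges of length one, and $B_{\mathcal{X}}(x,1)$ is the closed ball of radius $1$ (i.e. $x$ and its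 neighbours). The type of the vertex $[\mathcal{O}e_1\oplus\dots\oplus\mathcal{O}e_n]$ is $\tau=v(\det(e_1,\dots,e_n))\bmod n$ (Dieudonné determinant if $\mathbb{K}$ is not commutative); $\tau^{-1}(0)$ is the set of vertices of type $0$. *)

theory Defs
  imports "HOL-Analysis.Analysis" "HOL-Algebra.Generated_Groups"
    "HOL-Library.Extended_Nat"
begin

text \<open>A valuation is an integer-valued function whose value at 0 is irrelevant; the convention
  that \<open>v 0 = +\<infinity>\<close> is built into \<open>val_ge\<close>.\<close>

definition val_ge :: "('k::division_ring \<Rightarrow> int) \<Rightarrow> int \<Rightarrow> 'k \<Rightarrow> bool" where
  "val_ge v m x \<longleftrightarrow> x = 0 \<or> m \<le> v x"

definition discrete_valuation :: "('k::division_ring \<Rightarrow> int) \<Rightarrow> bool" where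
  "discrete_valuation v \<longleftrightarrow>
     v ` (UNIV - {0}) = UNIV \<and>
     (\<forall>x y. x \<noteq> 0 \<longrightarrow> y \<noteq> 0 \<longrightarrow> v (x * y) = v x + v y) \<and>
     (\<forall>x y. x \<noteq> 0 \<longrightarrow> y \<noteq> 0 \<longrightarrow> x + y \<noteq> 0 \<longrightarrow> min (v x) (v y) \<le> v (x + y))"

definition valuation_topology :: "('k::division_ring \<Rightarrow> int) \<Rightarrow> 'k topology" where
  "valuation_topology v = topology_generated_by {{y. val_ge v m (y - x)} | x m. True}"

definition local_skew_field :: "('k::division_ring \<Rightarrow> int) \<Rightarrow> bool" where
  "local_skew_field v \<longleftrightarrow>
     discrete_valuation v \<and> locally_compact_space (valuation_topology v)"

definition valuation_ring :: "('k::division_ring \<Rightarrow> int) \<Rightarrow> 'k set" where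
  "valuation_ring v = {x. val_ge v 0 x}"

definition uniformizer :: "('k::division_ring \<Rightarrow> int) \<Rightarrow> 'k \<Rightarrow> bool" where
  "uniformizer v p \<longleftrightarrow> {x. val_ge v 1 x} = {a * p | a. a \<in> valuation_ring v}"


text \<open>\<open>'k ^ 'n\<close> is viewed as a left vector space. A family \<open>e :: 'k ^ 'n ^ 'n\<close> of \<open>n\<close> vectors is
  the matrix with rows \<open>e $ i\<close>, so that replacing \<open>e\<close> by \<open>A ** e\<close> is the change of family by left
  linear combinations. (The library's \<open>v*\<close> and \<open>vec.span\<close> are only suitable for commutative
  scalars.)\<close>

definition lincomb :: "'k::division_ring ^ 'n \<Rightarrow> 'k ^ 'n ^ 'n \<Rightarrow> 'k ^ 'n" where
  "lincomb a e = (\<Sum>i\<in>UNIV. (a $ i) *s (e $ i))"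

definition is_basis :: "'k::division_ring ^ 'n ^ 'n \<Rightarrow> bool" where
  "is_basis e \<longleftrightarrow> (\<forall>a. lincomb a e = 0 \<longrightarrow> a = 0) \<and> (\<forall>x. \<exists>a. x = lincomb a e)"

definition lattice_of ::
  "('k::division_ring \<Rightarrow> int) \<Rightarrow> 'k ^ 'n ^ 'n \<Rightarrow> ('k ^ 'n) set" where
  "lattice_of v e = {lincomb a e | a. \<forall>i. a $ i \<in> valuation_ring v}"

definition is_lattice ::
  "('k::division_ring \<Rightarrow> int) \<Rightarrow> ('k ^ 'n) set \<Rightarrow> bool" where
  "is_lattice v L \<longleftrightarrow> (\<exists>e. is_basis e \<and> L = lattice_of v e)"

definition scale_set :: "'k::division_ring \<Rightarrow> ('k ^ 'n) set \<Rightarrow> ('k ^ 'n) set" where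
  "scale_set a L = (\<lambda>x. a *s x) ` L"

definition homothety_class :: "('k::division_ring ^ 'n) set \<Rightarrow> ('k ^ 'n) set set" where
  "homothety_class L = {scale_set a L | a. a \<noteq> 0}"

definition vertices ::
  "('k::division_ring \<Rightarrow> int) \<Rightarrow> ('k ^ 'n) set set set" where
  "vertices v = {homothety_class L | L. is_lattice v L}"

text \<open>Adjacency is symmetric although \<open>L1\<close> is taken in the first vertex: from
  \<open>pL1 \<subseteq> L2 \<subseteq> L1\<close> one gets \<open>pL2 \<subseteq> pL1 \<subseteq> L2\<close>. Both inclusions are strict since \<open>x \<noteq> y\<close>.\<close>

definition adjacent ::
  "('k::division_ring \<Rightarrow> int) \<Rightarrow> ('k ^ 'n) set set \<Rightarrow> ('k ^ 'n) set set \<Rightarrow> bool" where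
  "adjacent v x y \<longleftrightarrow>
     x \<in> vertices v \<and> y \<in> vertices v \<and> x \<noteq> y \<and>
     (\<exists>p L1 L2. uniformizer v p \<and> L1 \<in> x \<and> L2 \<in> y \<and> scale_set p L1 \<subseteq> L2 \<and> L2 \<subseteq> L1)"

definition graph_dist ::
  "('k::division_ring \<Rightarrow> int) \<Rightarrow> ('k ^ 'n) set set \<Rightarrow> ('k ^ 'n) set set \<Rightarrow> enat" where
  "graph_dist v x y = (INF k\<in>{k. (adjacent v ^^ k) x y}. enat k)"

text \<open>Only the vertices of the closed ball of the metric graph are recorded.\<close>

definition vertex_ball ::
  "('k::division_ring \<Rightarrow> int) \<Rightarrow> ('k ^ 'n) set set \<Rightarrow> nat \<Rightarrow> ('k ^ 'n) set set set" where
  "vertex_ball v x r = {y \<in> vertices v. graph_dist v x y \<le> enat r}"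


text \<open>The Dieudonne determinant, with values in the abelianization of the multiplicative group.
  An invertible matrix can be written \<open>E ** D\<close> with \<open>E\<close> a product of transvections and \<open>D\<close> a
  diagonal matrix with entries 1 except for one entry \<open>c\<close>; the determinant is the class of \<open>c\<close>
  modulo commutators. By Dieudonne's theorem this class depends neither on the decomposition nor
  on the position of \<open>c\<close>. Over a field it is the singleton of the usual determinant.\<close>

definition mult_group :: "'k::division_ring monoid" where
  "mult_group = \<lparr>carrier = UNIV - {0}, monoid.mult = (*), one = 1\<rparr>"

definition transvection :: "'n \<Rightarrow> 'n \<Rightarrow> 'k::division_ring \<Rightarrow> 'k ^ 'n ^ 'n" where
  "transvection i j a =
     (\<chi> k l. if k = l then 1 else if k = i \<and> l = j then a else 0)"

inductive_set elementary_group :: "('k::division_ring ^ 'n ^ 'n) set" where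
  one: "mat 1 \<in> elementary_group"
| step: "i \<noteq> j \<Longrightarrow> E \<in> elementary_group \<Longrightarrow> transvection i j a ** E \<in> elementary_group"

definition dilation :: "'n \<Rightarrow> 'k::division_ring \<Rightarrow> 'k ^ 'n ^ 'n" where
  "dilation i c = (\<chi> k l. if k = l then (if k = i then c else 1) else 0)"

definition dieudonne_det :: "'k::division_ring ^ 'n ^ 'n \<Rightarrow> 'k set" where
  "dieudonne_det A =
     derived mult_group (carrier mult_group) #>\<^bsub>mult_group\<^esub>
       (SOME c. c \<noteq> 0 \<and> (\<exists>E\<in>elementary_group. \<exists>i. A = E ** dilation i c))"

text \<open>A valuation is constant on classes modulo commutators.\<close>

definition class_val :: "('k::division_ring \<Rightarrow> int) \<Rightarrow> 'k set \<Rightarrow> int" where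
  "class_val v C = the_elem (v ` C)"

definition vertex_type ::
  "('k::division_ring \<Rightarrow> int) \<Rightarrow> ('k ^ 'n) set set \<Rightarrow> int" where
  "vertex_type v x =
     (THE t. \<exists>e :: 'k ^ 'n ^ 'n. is_basis e \<and> x = homothety_class (lattice_of v e) \<and>
        t = class_val v (dieudonne_det e) mod int CARD('n))"

definition vertex_print ::
  "('k::division_ring \<Rightarrow> int) \<Rightarrow> ('k ^ 'n) set set \<Rightarrow> ('k ^ 'n) set set set" where
  "vertex_print v x = vertex_ball v x 1 \<inter> {y \<in> vertices v. vertex_type v y = 0}"

end

theory Submission
  imports Defs
begin

text \<open>
  Let \<open>\<pi>\<close> be a uniformizer and let \<open>covolume L\<close> be the valuation of the determinant of a basis of
  the lattice \<open>L\<close>. Multiplying \<open>L\<close> by a scalar \<open>a\<close> adds \<open>n v(a)\<close> to it, and fixes \<open>L\<close> if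
  \<open>v(a) = 0\<close>. So a vertex of type 0 has exactly one representative of covolume 0, and every vertex
  \<open>x\<close> has exactly one representative \<open>L\<close> with \<open>- n < covolume L \<le> 0\<close>.

  In terms of these representatives the print of \<open>x\<close> consists of the lattices \<open>M\<close> of covolume 0 with
  \<open>\<pi>L \<subseteq> M \<subseteq> L\<close>: lattices squeezed between \<open>\<pi>L\<close> and \<open>L\<close> have covolume between \<open>covolume L\<close> and
  \<open>covolume L + n\<close>, and 0 is the only multiple of \<open>n\<close> in this range, except that \<open>n\<close> is another one
  if \<open>covolume L = 0\<close>, where it only gives \<open>\<pi>L\<close> itself. This is \<open>print_lattice_subset\<close>.
  Conversely, given a basis \<open>e\<close> of \<open>L\<close>, multiplying \<open>- covolume L < n\<close> of the basis vectors by \<open>\<pi>\<close>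
  produces such an \<open>M\<close>, and any one vector of the basis can be left alone
  (\<open>ex_print_lattice_containing\<close>). Hence \<open>L\<close> is the sum of the lattices \<open>M\<close>, and the print
  determines \<open>L\<close>, therefore \<open>x\<close>.

  What takes more work is that the valuation of the Dieudonne determinant is well defined and
  measures lattices. The covolume is therefore introduced without determinants, by the leading
  coefficients of the elements of a module along the coordinate flag. It is strictly monotone, and
  adjoining an element \<open>y \<notin> M\<close> with \<open>\<pi>y \<in> M\<close> lowers it by 1 (\<open>covolume_adjoin\<close>). Differences of
  covolumes of nested lattices thus count the steps of a chain and are invariant under linear
  automorphisms, which makes \<open>A \<mapsto> covolume (\<O>\<^sup>nA)\<close> a homomorphism from \<open>GL\<^sub>n(K)\<close> to the integers. It
  vanishes on transvections and takes the value \<open>v(c)\<close> on a dilation of coefficient \<open>c\<close>. Since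
  Gaussian elimination writes every invertible matrix as a product of transvections times a
  dilation, it is the valuation of the determinant (\<open>class_val_dieudonne_det\<close>).
\<close>

section \<open>Valuations\<close>

locale discretely_valued =
  fixes v :: "'k::division_ring \<Rightarrow> int"
  assumes discrete: "discrete_valuation v"
begin

lemma val_mult: "x \<noteq> 0 \<Longrightarrow> y \<noteq> 0 \<Longrightarrow> v (x * y) = v x + v y"
  using discrete by (auto simp: discrete_valuation_def)

lemma val_one [simp]: "v 1 = 0"
  using val_mult[of 1 1] by simp

lemma val_minus [simp]: "v (- x) = v x"
proof (cases "x = 0")
  case False
  have "v (- 1) = 0" using val_mult[of "- 1" "- 1"] by simp
  then show ?thesis using val_mult[of "- 1" x] False by simp
qed simp

lemma val_inverse: "x \<noteq> 0 \<Longrightarrow> v (inverse x) = - v x"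
  using val_mult[of x "inverse x"] by simp

lemma ex_val: "\<exists>x. x \<noteq> 0 \<and> v x = k"
proof -
  have "k \<in> v ` (UNIV - {0})" using discrete by (simp add: discrete_valuation_def)
  then show ?thesis by blast
qed

lemma val_ge_zero [simp]: "val_ge v m 0"
  by (simp add: val_ge_def)

lemma val_ge_add: "val_ge v m x \<Longrightarrow> val_ge v m y \<Longrightarrow> val_ge v m (x + y)"
proof -
  assume a: "val_ge v m x" "val_ge v m y"
  show "val_ge v m (x + y)"
  proof (cases "x = 0 \<or> y = 0 \<or> x + y = 0")
    case False
    then have "min (v x) (v y) \<le> v (x + y)"
      using discrete by (simp add: discrete_valuation_def)
    then show ?thesis using a False by (auto simp: val_ge_def)
  qed (use a in \<open>auto simp: val_ge_def\<close>)
qed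

lemma val_ge_mult: "val_ge v m x \<Longrightarrow> val_ge v k y \<Longrightarrow> val_ge v (m + k) (x * y)"
  by (cases "x = 0 \<or> y = 0") (auto simp: val_ge_def val_mult)

lemma val_ge_sum: "(\<And>i. i \<in> A \<Longrightarrow> val_ge v m (f i)) \<Longrightarrow> val_ge v m (\<Sum>i\<in>A. f i)"
  by (induction A rule: infinite_finite_induct) (auto intro: val_ge_add)

lemma val_ge_mono: "val_ge v m x \<Longrightarrow> k \<le> m \<Longrightarrow> val_ge v k x"
  by (auto simp: val_ge_def)

lemma mem_valuation_ring: "a \<in> valuation_ring v \<longleftrightarrow> val_ge v 0 a"
  by (simp add: valuation_ring_def)

lemma uniformizer_iff: "uniformizer v p \<longleftrightarrow> p \<noteq> 0 \<and> v p = 1"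
proof
  assume u: "uniformizer v p"
  obtain t where t: "t \<noteq> 0" "v t = 1" using ex_val by blast
  then have "t \<in> {x. val_ge v 1 x}" by (simp add: val_ge_def)
  then obtain a where a: "a \<in> valuation_ring v" "t = a * p"
    using u unfolding uniformizer_def by blast
  have "1 * p \<in> {a * p |a. a \<in> valuation_ring v}"
    by (intro CollectI exI[of _ 1] conjI) (simp_all add: mem_valuation_ring val_ge_def)
  then have "1 * p \<in> {x. val_ge v 1 x}"
    using u unfolding uniformizer_def by blast
  then show "p \<noteq> 0 \<and> v p = 1"
    using a t val_mult[of a p] by (auto simp: mem_valuation_ring val_ge_def)
next
  assume p: "p \<noteq> 0 \<and> v p = 1"
  show "uniformizer v p"
    unfolding uniformizer_def
  proof (rule equalityI; rule subsetI)
    fix x assume "x \<in> {x. val_ge v 1 x}"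
    then have "val_ge v (1 + - 1) (x * inverse p)"
      using p by (intro val_ge_mult) (auto simp: val_ge_def val_inverse)
    moreover have "x = (x * inverse p) * p" using p by (simp add: mult.assoc)
    ultimately show "x \<in> {a * p |a. a \<in> valuation_ring v}"
      by (auto simp: mem_valuation_ring)
  next
    fix x assume "x \<in> {a * p |a. a \<in> valuation_ring v}"
    then obtain a where "x = a * p" "val_ge v 0 a" by (auto simp: mem_valuation_ring)
    then show "x \<in> {x. val_ge v 1 x}"
      using p val_ge_mult[of 0 a 1 p] by (simp add: val_ge_def)
  qed
qed

section \<open>Full modules and their covolume\<close>

definition cube :: "int \<Rightarrow> ('k ^ 'n) set" where
  "cube m = {x. \<forall>i. val_ge v m (x $ i)}"

text \<open>The lattices, described without reference to a basis: the modules commensurable with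
  \<open>cube 0\<close>. In this form they are visibly stable under the enlargements \<open>M + \<O>y\<close> used below,
  for which no basis has to be exhibited.\<close>

definition full_module :: "('k ^ 'n) set \<Rightarrow> bool" where
  "full_module M \<longleftrightarrow>
     (\<forall>x\<in>M. \<forall>y\<in>M. x + y \<in> M) \<and> (\<forall>a\<in>valuation_ring v. \<forall>x\<in>M. a *s x \<in> M) \<and>
     (\<exists>m. cube m \<subseteq> M) \<and> (\<exists>m. M \<subseteq> cube m)"

definition leads :: "'n::finite \<Rightarrow> 'k ^ 'n \<Rightarrow> bool" where
  "leads i x \<longleftrightarrow> x $ i \<noteq> 0 \<and> (\<forall>j. to_nat i < to_nat j \<longrightarrow> x $ j = 0)"

definition lead_val :: "('k ^ 'n) set \<Rightarrow> 'n::finite \<Rightarrow> int" where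
  "lead_val M i = Inf {v (x $ i) | x. x \<in> M \<and> leads i x}"

text \<open>The filtration of \<open>K\<^sup>n\<close> by the coordinate flag cuts a module into \<open>n\<close> fractional ideals of
  \<open>K\<close>, generated by elements of valuation \<open>lead_val M i\<close>. The sum of these numbers is the length of
  \<open>\<O>\<^sup>n / M\<close> when \<open>M \<subseteq> \<O>\<^sup>n\<close>, and its extension to all lattices otherwise.\<close>

definition covolume :: "('k ^ 'n::finite) set \<Rightarrow> int" where
  "covolume M = (\<Sum>i\<in>UNIV. lead_val M i)"

lemma cube_antimono: "m \<le> k \<Longrightarrow> cube k \<subseteq> cube m"
  by (auto simp: cube_def intro: val_ge_mono)

lemma full_module_add: "full_module M \<Longrightarrow> x \<in> M \<Longrightarrow> y \<in> M \<Longrightarrow> x + y \<in> M"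
  and full_module_smult: "full_module M \<Longrightarrow> val_ge v 0 a \<Longrightarrow> x \<in> M \<Longrightarrow> a *s x \<in> M"
  by (auto simp: full_module_def mem_valuation_ring)

lemma full_module_zero: "full_module M \<Longrightarrow> 0 \<in> M"
  by (force simp: full_module_def cube_def)

lemma full_module_uminus: "full_module M \<Longrightarrow> x \<in> M \<Longrightarrow> - x \<in> M"
  using full_module_smult[of M "- 1" x]
  by (simp add: val_ge_def vector_sneg_minus1[symmetric])

lemma full_module_diff: "full_module M \<Longrightarrow> x \<in> M \<Longrightarrow> y \<in> M \<Longrightarrow> x - y \<in> M"
  using full_module_add[of M x "- y"] full_module_uminus[of M y] by simp

lemma full_module_sum:
  "full_module M \<Longrightarrow> (\<And>i. i \<in> A \<Longrightarrow> f i \<in> M) \<Longrightarrow> (\<Sum>i\<in>A. f i) \<in> M"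
  by (induction A rule: infinite_finite_induct) (auto intro: full_module_add full_module_zero)

lemma full_module_cube: "full_module (cube m)"
  using val_ge_mult[of 0 _ m]
  by (auto simp: full_module_def cube_def mem_valuation_ring intro: val_ge_add)

lemma ex_leads: "x \<noteq> 0 \<Longrightarrow> \<exists>i. leads i x"
proof -
  assume "x \<noteq> 0"
  then obtain j where j: "x $ j \<noteq> 0" by (auto simp: vec_eq_iff)
  define S where "S = {i. x $ i \<noteq> 0}"
  have "Max (to_nat ` S) \<in> to_nat ` S"
    using j by (intro Max_in) (auto simp: S_def)
  then obtain i where i: "i \<in> S" "to_nat i = Max (to_nat ` S)" by auto
  have "x $ j = 0" if "to_nat i < to_nat j" for j
  proof (rule ccontr)
    assume "x $ j \<noteq> 0"
    then have "to_nat j \<le> Max (to_nat ` S)" by (intro Max_ge) (auto simp: S_def)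
    then show False using i that by simp
  qed
  moreover have "x $ i \<noteq> 0" using i(1) by (simp add: S_def)
  ultimately show ?thesis unfolding leads_def by blast
qed

lemma leads_axis: "leads i (axis i (1::'k))"
  by (auto simp: leads_def axis_def)

lemma leads_smult: "a \<noteq> 0 \<Longrightarrow> leads i (a *s x) \<longleftrightarrow> leads i x"
  by (simp add: leads_def)

lemma lead_val_eqI:
  assumes "y \<in> M" "leads i y" "v (y $ i) = k" "\<And>x. x \<in> M \<Longrightarrow> leads i x \<Longrightarrow> k \<le> v (x $ i)"
  shows "lead_val M i = k"
  unfolding lead_val_def using assms by (intro cInf_eq_minimum) auto

lemma
  assumes M: "full_module M"
  shows lead_val_attained: "\<exists>x\<in>M. leads i x \<and> v (x $ i) = lead_val M i"
    and lead_val_le: "x \<in> M \<Longrightarrow> leads i x \<Longrightarrow> lead_val M i \<le> v (x $ i)"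
proof -
  let ?X = "{v (x $ i) | x. x \<in> M \<and> leads i x}"
  obtain m k where mk: "cube m \<subseteq> M" "M \<subseteq> cube k" using M by (auto simp: full_module_def)
  obtain t where t: "t \<noteq> 0" "v t = m" using ex_val by blast
  have "t *s axis i 1 \<in> cube m" using t by (simp add: cube_def axis_def val_ge_def)
  then have "v ((t *s axis i 1) $ i) \<in> ?X"
    using mk(1) t leads_axis[of i] leads_smult[of t i "axis i 1"] by blast
  then have ne: "?X \<noteq> {}" by blast
  have bdd: "bdd_below ?X"
  proof (rule bdd_belowI)
    fix l assume "l \<in> ?X"
    then obtain x where x: "l = v (x $ i)" "x \<in> cube k" "leads i x" using mk(2) by blast
    then show "k \<le> l" by (simp add: cube_def val_ge_def leads_def) metis
  qed
  have "Inf ?X \<in> ?X"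
  proof (rule ccontr)
    assume n: "Inf ?X \<notin> ?X"
    have "Inf ?X + 1 \<le> Inf ?X"
    proof (rule cInf_greatest[OF ne])
      fix y assume y: "y \<in> ?X"
      then have "Inf ?X \<le> y" using bdd by (intro cInf_lower)
      moreover have "y \<noteq> Inf ?X" using n y by metis
      ultimately show "Inf ?X + 1 \<le> y" by simp
    qed
    then show False by simp
  qed
  then show "\<exists>x\<in>M. leads i x \<and> v (x $ i) = lead_val M i" by (auto simp: lead_val_def)
  show "x \<in> M \<Longrightarrow> leads i x \<Longrightarrow> lead_val M i \<le> v (x $ i)"
    unfolding lead_val_def using bdd by (intro cInf_lower) auto
qed

lemma lead_val_antimono:
  assumes "full_module M" "full_module N" "M \<subseteq> N"
  shows "lead_val N i \<le> lead_val M i"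
  using lead_val_attained[OF assms(1), of i] lead_val_le[OF assms(2), of _ i] assms(3) by force

lemma covolume_antimono:
  "full_module M \<Longrightarrow> full_module N \<Longrightarrow> M \<subseteq> N \<Longrightarrow> covolume N \<le> covolume M"
  unfolding covolume_def by (intro sum_mono lead_val_antimono)

text \<open>Division with remainder along the flag: subtracting a multiple of an element of \<open>M\<close> with
  minimal leading valuation lowers the position of the leading coordinate, so that every element
  of \<open>N\<close> reduces to 0 modulo \<open>M\<close>.\<close>

lemma full_module_eqI:
  fixes M :: "('k ^ 'n::finite) set"
  assumes M: "full_module M" and N: "full_module N" and sub: "M \<subseteq> N"
    and eq: "\<And>i. lead_val M i = lead_val N i"
  shows "M = N"
proof
  have "x \<in> N \<Longrightarrow> leads i x \<Longrightarrow> x \<in> M" for x i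
  proof (induction "to_nat i" arbitrary: x i rule: less_induct)
    case less
    obtain y where y: "y \<in> M" "leads i y" "v (y $ i) = lead_val M i"
      using lead_val_attained[OF M] by blast
    define a where "a = x $ i * inverse (y $ i)"
    have nz: "x $ i \<noteq> 0" "y $ i \<noteq> 0" using less.prems y by (auto simp: leads_def)
    have a: "val_ge v 0 a"
      using nz y lead_val_le[OF N less.prems] eq by (auto simp: a_def val_ge_def val_mult val_inverse)
    have ay: "a *s y \<in> M" using full_module_smult[OF M a y(1)] .
    define z where "z = x - a *s y"
    have zN: "z \<in> N" unfolding z_def using less.prems(1) ay sub by (auto intro: full_module_diff[OF N])
    have "z $ i = 0" using nz by (simp add: z_def a_def mult.assoc)
    then have z0: "z $ j = 0" if "to_nat i \<le> to_nat j" for j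
      using that less.prems(2) y(2) by (cases "i = j") (auto simp: z_def leads_def le_less)
    have "z \<in> M"
    proof (cases "z = 0")
      case True
      then show ?thesis using full_module_zero[OF M] by simp
    next
      case False
      then obtain j where j: "leads j z" using ex_leads by blast
      then have "\<not> to_nat i \<le> to_nat j" using z0[of j] by (auto simp: leads_def)
      then have "to_nat j < to_nat i" by simp
      then show ?thesis using less.hyps zN j by blast
    qed
    then show ?case using full_module_add[OF M _ ay, of z] by (simp add: z_def)
  qed
  then show "N \<subseteq> M" using ex_leads full_module_zero[OF M] by (metis subsetI)
qed (fact sub)

lemma covolume_eq_imp_eq:
  fixes M :: "('k ^ 'n::finite) set"
  assumes M: "full_module M" and N: "full_module N" and sub: "M \<subseteq> N"
    and eq: "covolume M = covolume N"
  shows "M = N"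
proof (rule full_module_eqI[OF M N sub])
  fix i
  have "(\<Sum>i\<in>UNIV. lead_val M i - lead_val N i) = 0"
    using eq by (simp add: covolume_def sum_subtractf)
  then show "lead_val M i = lead_val N i"
    using lead_val_antimono[OF M N sub] by (subst (asm) sum_nonneg_eq_0_iff) auto
qed

definition adjoin :: "('k ^ 'n) set \<Rightarrow> 'k ^ 'n \<Rightarrow> ('k ^ 'n) set" where
  "adjoin M y = {x + a *s y | x a. x \<in> M \<and> val_ge v 0 a}"

lemma adjoinE:
  assumes "z \<in> adjoin M y"
  obtains u a where "z = u + a *s y" "u \<in> M" "val_ge v 0 a"
  using assms by (auto simp: adjoin_def)

lemma adjoinI: "u \<in> M \<Longrightarrow> val_ge v 0 a \<Longrightarrow> u + a *s y \<in> adjoin M y"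
  by (auto simp: adjoin_def)

lemma subset_adjoin: "M \<subseteq> adjoin M y"
  using adjoinI[of _ M 0 y] by auto

lemma mem_adjoin: "full_module M \<Longrightarrow> y \<in> adjoin M y"
  using adjoinI[of 0 M 1 y] by (simp add: full_module_zero val_ge_def)

lemma full_module_adjoin:
  fixes M :: "('k ^ 'n) set"
  assumes M: "full_module M"
  shows "full_module (adjoin M y)"
proof -
  obtain m k where mk: "cube m \<subseteq> M" "M \<subseteq> cube k" using M by (auto simp: full_module_def)
  have sub: "M \<subseteq> adjoin M y" by (rule subset_adjoin)
  have "\<exists>k'. y \<in> cube k'"
  proof -
    have "y \<in> cube (Min ((\<lambda>i. v (y $ i)) ` UNIV))"
      by (auto simp: cube_def val_ge_def)
    then show ?thesis ..
  qed
  then obtain k' where k': "y \<in> cube k'" by blast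
  have "adjoin M y \<subseteq> cube (min k k')"
  proof
    fix z assume "z \<in> adjoin M y"
    then obtain x a where xa: "z = x + a *s y" "x \<in> M" "val_ge v 0 a" by (auto simp: adjoin_def)
    have "x \<in> cube (min k k')" "y \<in> cube (min k k')"
      using mk xa(2) k' cube_antimono[of "min k k'" k] cube_antimono[of "min k k'" k'] by auto
    then show "z \<in> cube (min k k')"
      using xa(1,3) full_module_add full_module_smult full_module_cube by metis
  qed
  moreover have "x + y' \<in> adjoin M y" if xy: "x \<in> adjoin M y" "y' \<in> adjoin M y" for x y'
  proof -
    obtain u a u' a' where "x = u + a *s y" "y' = u' + a' *s y" "u \<in> M" "u' \<in> M"
      "val_ge v 0 a" "val_ge v 0 a'" using xy by (elim adjoinE)
    then have "x + y' = (u + u') + (a + a') *s y" "u + u' \<in> M" "val_ge v 0 (a + a')"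
      using full_module_add[OF M] val_ge_add by (auto simp: vector_sadd_rdistrib)
    then show ?thesis by (metis adjoinI)
  qed
  moreover have "b *s x \<in> adjoin M y" if bx: "val_ge v 0 b" "x \<in> adjoin M y" for x b
  proof -
    obtain u a where "x = u + a *s y" "u \<in> M" "val_ge v 0 a" using bx(2) by (elim adjoinE)
    then have "b *s x = b *s u + (b * a) *s y" "b *s u \<in> M" "val_ge v 0 (b * a)"
      using that full_module_smult[OF M] val_ge_mult[of 0 b 0 a]
      by (auto simp: vector_add_ldistrib vector_smult_assoc)
    then show ?thesis by (metis adjoinI)
  qed
  moreover have "cube m \<subseteq> adjoin M y" using mk(1) sub by (rule order_trans)
  ultimately show ?thesis
    unfolding full_module_def by (intro conjI ballI exI) (simp_all add: mem_valuation_ring)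
qed

text \<open>If \<open>\<pi>y \<in> M\<close>, the quotient of \<open>M + \<O>y\<close> by \<open>M\<close> is the residue skew field, of length 1. In
  terms of leading valuations: none can drop by more than 1 as \<open>\<pi>(M + \<O>y) \<subseteq> M\<close>, and two of them
  cannot drop at once, because two elements witnessing this would both be unit multiples of \<open>y\<close>
  modulo \<open>M\<close>, so that a unit multiple of the one with the smaller leading position could be
  subtracted from the other to land in \<open>M\<close> with an unchanged leading term.\<close>

lemma covolume_adjoin:
  fixes M :: "('k ^ 'n::finite) set"
  assumes M: "full_module M" and y: "y \<notin> M" and p: "p \<noteq> 0" "v p = 1" and py: "p *s y \<in> M"
  shows "covolume (adjoin M y) = covolume M - 1"
proof -
  let ?N = "adjoin M y"
  have N: "full_module ?N" by (rule full_module_adjoin[OF M])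
  have MN: "M \<subseteq> ?N" by (rule subset_adjoin)
  have yN: "y \<in> ?N" by (rule mem_adjoin[OF M])
  have posM: "a *s y \<in> M" if "val_ge v 1 a" for a
  proof -
    have "val_ge v (1 + - 1) (a * inverse p)"
      using p that by (intro val_ge_mult) (auto simp: val_ge_def val_inverse)
    then have "(a * inverse p) *s (p *s y) \<in> M" using full_module_smult[OF M _ py] by simp
    then show ?thesis using p by (simp add: vector_smult_assoc mult.assoc)
  qed
  have unit: "\<exists>u a. x = u + a *s y \<and> u \<in> M \<and> a \<noteq> 0 \<and> v a = 0" if x: "x \<in> ?N" "x \<notin> M" for x
  proof -
    obtain u a where ua: "x = u + a *s y" "u \<in> M" "val_ge v 0 a"
      using x(1) by (elim adjoinE)
    have "\<not> val_ge v 1 a" using posM[of a] ua that(2) full_module_add[OF M] by blast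
    then have "a \<noteq> 0 \<and> v a = 0" using ua(3) by (auto simp: val_ge_def)
    then show ?thesis using ua by blast
  qed
  have drop1: "lead_val M i \<le> lead_val ?N i + 1" for i
  proof -
    obtain x where x: "x \<in> ?N" "leads i x" "v (x $ i) = lead_val ?N i"
      using lead_val_attained[OF N] by blast
    obtain u a where ua: "x = u + a *s y" "u \<in> M" "val_ge v 0 a"
      using x(1) by (elim adjoinE)
    have "p *s x = p *s u + (p * a) *s y" by (simp add: ua vector_add_ldistrib vector_smult_assoc)
    moreover have "val_ge v 1 (p * a)"
      using val_ge_mult[of 1 p 0 a] p ua by (simp add: val_ge_def)
    ultimately have "p *s x \<in> M"
      using posM full_module_add[OF M] full_module_smult[OF M, of p] ua(2) p by (auto simp: val_ge_def)
    then have "lead_val M i \<le> v ((p *s x) $ i)"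
      using x p by (intro lead_val_le[OF M]) (auto simp: leads_smult)
    then show ?thesis using p x by (simp add: val_mult leads_def)
  qed
  have single: False
    if ij: "to_nat i < to_nat j" and di: "lead_val ?N i < lead_val M i"
      and dj: "lead_val ?N j < lead_val M j" for i j
  proof -
    obtain x where x: "x \<in> ?N" "leads i x" "v (x $ i) = lead_val ?N i"
      using lead_val_attained[OF N] by blast
    obtain z where z: "z \<in> ?N" "leads j z" "v (z $ j) = lead_val ?N j"
      using lead_val_attained[OF N] by blast
    have "x \<notin> M" "z \<notin> M" using lead_val_le[OF M] x z di dj by fastforce+
    then obtain u a w b where uw: "x = u + a *s y" "u \<in> M" "a \<noteq> 0" "v a = 0"
      "z = w + b *s y" "w \<in> M" "b \<noteq> 0" "v b = 0"
      using unit x z by metis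
    define c where "c = b * inverse a"
    have c: "val_ge v 0 c" using uw by (simp add: c_def val_ge_def val_mult val_inverse)
    have "c * a = b" using uw by (simp add: c_def mult.assoc)
    then have "z - c *s x = w - c *s u"
      by (simp add: uw vector_add_ldistrib vector_smult_assoc)
    then have "z - c *s x \<in> M"
      using uw full_module_diff[OF M] full_module_smult[OF M c] by simp
    moreover have "leads j (z - c *s x)" "(z - c *s x) $ j = z $ j"
      using z(2) x(2) ij by (auto simp: leads_def)
    ultimately have "lead_val M j \<le> v (z $ j)" using lead_val_le[OF M] by metis
    then show False using z(3) dj by simp
  qed
  have "M \<noteq> ?N" using y yN by blast
  then obtain i where i: "lead_val M i \<noteq> lead_val ?N i"
    using full_module_eqI[OF M N MN] by blast
  have "lead_val ?N i = lead_val M i - 1"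
    using i drop1[of i] lead_val_antimono[OF M N MN, of i] by simp
  moreover have "lead_val ?N j = lead_val M j" if "j \<noteq> i" for j
  proof -
    have "to_nat i \<noteq> to_nat j" using that by simp
    moreover have "lead_val ?N i < lead_val M i"
      using i lead_val_antimono[OF M N MN, of i] by linarith
    ultimately have "\<not> lead_val ?N j < lead_val M j"
      using single[of i j] single[of j i] by (metis linorder_neqE_nat)
    then show ?thesis using lead_val_antimono[OF M N MN, of j] by linarith
  qed
  ultimately show ?thesis
    unfolding covolume_def by (simp add: sum.remove[of UNIV i])
qed

text \<open>The largest power of \<open>\<pi>\<close> that does not move an element of \<open>N - M\<close> into \<open>M\<close> produces \<open>y\<close>; it
  exists because \<open>\<pi>\<^sup>rN \<subseteq> M\<close> for large \<open>r\<close>.\<close>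

lemma ex_minimal_extension:
  fixes M :: "('k ^ 'n) set"
  assumes M: "full_module M" and N: "full_module N" and sub: "M \<subseteq> N" "M \<noteq> N"
    and p: "p \<noteq> 0" "v p = 1"
  shows "\<exists>y\<in>N. y \<notin> M \<and> p *s y \<in> M"
proof (rule ccontr)
  assume n: "\<not> ?thesis"
  obtain y where y: "y \<in> N" "y \<notin> M" using sub by blast
  have val_pow: "v (p ^ r) = int r" for r
    by (induction r) (auto simp: val_mult p)
  have pO: "val_ge v 0 p" using p by (simp add: val_ge_def)
  have it: "p ^ r *s y \<in> N \<and> p ^ r *s y \<notin> M" for r
  proof (induction r)
    case (Suc r)
    have "p ^ Suc r *s y = p *s (p ^ r *s y)" by (simp add: vector_smult_assoc)
    moreover have "p *s (p ^ r *s y) \<in> N"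
      using Suc full_module_smult[OF N pO] by blast
    ultimately show ?case using Suc n by metis
  qed (use y in simp)
  obtain m k where mk: "cube m \<subseteq> M" "N \<subseteq> cube k" using M N by (auto simp: full_module_def)
  define r where "r = nat (m - k)"
  have "p ^ r *s y \<in> cube m"
    unfolding cube_def
  proof (intro CollectI allI)
    fix i
    have "val_ge v (int r + k) (p ^ r * y $ i)"
      using y mk by (intro val_ge_mult) (auto simp: val_ge_def cube_def val_pow)
    then show "val_ge v m ((p ^ r *s y) $ i)"
      unfolding r_def by (auto elim: val_ge_mono)
  qed
  then show False using it mk by blast
qed

end

section \<open>Left linear algebra over a skew field\<close>

lemma lincomb_nth: "lincomb a e $ j = (\<Sum>i\<in>UNIV. a $ i * e $ i $ j)"
  by (simp add: lincomb_def sum_component)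

lemma lincomb_add: "lincomb (a + b) e = lincomb a e + lincomb b e"
  by (simp add: vec_eq_iff lincomb_nth distrib_right sum.distrib)

lemma lincomb_diff: "lincomb (a - b) e = lincomb a e - lincomb b e"
  by (simp add: vec_eq_iff lincomb_nth left_diff_distrib sum_subtractf)

lemma lincomb_smult: "lincomb (c *s a) e = c *s lincomb a e"
  by (simp add: vec_eq_iff lincomb_nth sum_distrib_left mult.assoc)

lemma lincomb_axis: "lincomb (axis i 1) e = e $ i"
  by (simp add: vec_eq_iff lincomb_nth axis_def if_distrib[of "\<lambda>x. x * _"] cong: if_cong)

lemma lincomb_mat_1: "lincomb a (mat 1) = a"
  by (simp add: vec_eq_iff lincomb_nth mat_def if_distrib[of "\<lambda>x. _ * x"] cong: if_cong)

lemma lincomb_lincomb: "lincomb (lincomb a e) f = lincomb a (e ** f)"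
proof -
  have "(\<Sum>i\<in>UNIV. (\<Sum>k\<in>UNIV. a $ k * e $ k $ i) * f $ i $ j)
      = (\<Sum>k\<in>UNIV. a $ k * (\<Sum>i\<in>UNIV. e $ k $ i * f $ i $ j))" for j
    by (simp add: sum_distrib_left sum_distrib_right mult.assoc) (rule sum.swap)
  then show ?thesis by (simp add: vec_eq_iff lincomb_nth matrix_matrix_mult_def)
qed

lemma row_mult: "(A ** B) $ i = lincomb (A $ i) B"
  by (simp add: vec_eq_iff lincomb_nth matrix_matrix_mult_def)

lemma is_basis_iff_invertible: "is_basis e \<longleftrightarrow> invertible e"
proof
  assume e: "is_basis e"
  have "\<forall>i. \<exists>b. axis i 1 = lincomb b e" using e by (simp add: is_basis_def)
  then obtain b where b: "\<And>i. axis i 1 = lincomb (b i) e" by metis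
  define B where "B = (\<chi> i. b i)"
  have B: "B ** e = mat 1"
    by (auto simp: vec_eq_iff row_mult B_def b[symmetric] axis_def mat_def)
  have "lincomb ((e ** B) $ i - axis i 1) e = 0" for i
    by (simp add: lincomb_diff row_mult lincomb_lincomb matrix_mul_assoc[symmetric] B lincomb_axis)
      (simp add: lincomb_lincomb matrix_mul_assoc[symmetric] B lincomb_mat_1)
  then have "(e ** B) $ i = axis i 1" for i
    using e unfolding is_basis_def by (metis right_minus_eq)
  then have "e ** B = mat 1" by (auto simp: vec_eq_iff axis_def mat_def)
  then show "invertible e" using B unfolding invertible_def by blast
next
  assume "invertible e"
  then obtain B where B: "e ** B = mat 1" "B ** e = mat 1" unfolding invertible_def by blast
  have "x = lincomb (lincomb x B) e" for x using B by (simp add: lincomb_lincomb lincomb_mat_1)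
  moreover have "a = lincomb (lincomb a e) B" for a
    using B by (simp add: lincomb_lincomb lincomb_mat_1)
  then have "lincomb a e = 0 \<Longrightarrow> a = 0" for a by (metis lincomb_smult vector_smult_lzero)
  ultimately show "is_basis e" unfolding is_basis_def by blast
qed

lemma invertible_product:
  fixes A B :: "'k::division_ring ^ 'n ^ 'n"
  assumes "invertible A" "invertible B"
  shows "invertible (A ** B)"
proof -
  obtain A' B' where "A ** A' = mat 1" "A' ** A = mat 1" "B ** B' = mat 1" "B' ** B = mat 1"
    using assms unfolding invertible_def by blast
  then have "(A ** B) ** (B' ** A') = mat 1" "(B' ** A') ** (A ** B) = mat 1"
    by (metis matrix_mul_assoc matrix_mul_rid)+
  then show ?thesis unfolding invertible_def by blast
qed

definition diag :: "('n \<Rightarrow> 'k::division_ring) \<Rightarrow> 'k ^ 'n ^ 'n" where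
  "diag d = (\<chi> i j. if i = j then d i else 0)"

lemma dilation_eq_diag: "dilation i c = diag (\<lambda>k. if k = i then c else 1)"
  by (simp add: dilation_def diag_def)

lemma lincomb_diag: "lincomb x (diag d) $ j = x $ j * d j"
  by (simp add: lincomb_nth diag_def if_distrib[of "\<lambda>x. _ * x"] cong: if_cong)

lemma diag_mult: "(diag d ** A) $ i = d i *s A $ i"
  by (simp add: vec_eq_iff matrix_matrix_mult_def diag_def if_distrib[of "\<lambda>x. x * _"] cong: if_cong)

lemma invertible_diag:
  assumes "\<And>i. d i \<noteq> 0"
  shows "invertible (diag d)"
proof -
  have "diag d ** diag (\<lambda>i. inverse (d i)) = mat 1" "diag (\<lambda>i. inverse (d i)) ** diag d = mat 1"
    using assms by (auto simp: vec_eq_iff diag_mult) (auto simp: diag_def mat_def)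
  then show ?thesis unfolding invertible_def by blast
qed

lemma transvection_mult:
  assumes "i \<noteq> j"
  shows "(transvection i j a ** A) $ k = (if k = i then A $ i + a *s A $ j else A $ k)"
proof -
  have "(\<Sum>l\<in>UNIV. (if k = l then 1 else if k = i \<and> l = j then a else 0) * A $ l $ m)
      = (\<Sum>l\<in>UNIV. (if l = k then A $ l $ m else 0)
          + (if l = j then (if k = i then a * A $ l $ m else 0) else 0))" for m
    using assms by (intro sum.cong) auto
  then show ?thesis
    by (auto simp: vec_eq_iff matrix_matrix_mult_def transvection_def sum.distrib)
qed

lemma transvection_inverse:
  fixes a :: "'k::division_ring"
  assumes "i \<noteq> j"
  shows "transvection i j a ** transvection i j (- a) = (mat 1 :: 'k ^ 'n ^ 'n)"
proof -
  have "transvection i j a ** (transvection i j (- a) ** mat 1) = (mat 1 :: 'k ^ 'n ^ 'n)"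
    using assms by (simp add: vec_eq_iff transvection_mult del: matrix_mul_rid)
  then show ?thesis by simp
qed

lemma invertible_transvection: "i \<noteq> j \<Longrightarrow> invertible (transvection i j a)"
  unfolding invertible_def using transvection_inverse[of i j a] transvection_inverse[of i j "- a"]
  by auto

lemma invertible_elementary: "E \<in> elementary_group \<Longrightarrow> invertible E"
proof (induction rule: elementary_group.induct)
  case one
  then show ?case unfolding invertible_def using matrix_mul_lid by blast
qed (simp add: invertible_product invertible_transvection)

section \<open>Gaussian elimination by transvections\<close>

definition reducible_to_dilation :: "'k::division_ring ^ 'n ^ 'n \<Rightarrow> bool" where
  "reducible_to_dilation A \<longleftrightarrow> (\<exists>c. c \<noteq> 0 \<and> (\<exists>E\<in>elementary_group. \<exists>i. A = E ** dilation i c))"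

lemma reducible_to_dilation_transvection:
  assumes ij: "i \<noteq> j" and red: "reducible_to_dilation (transvection i j a ** A)"
  shows "reducible_to_dilation A"
proof -
  obtain c E k where c: "c \<noteq> 0" "E \<in> elementary_group" "transvection i j a ** A = E ** dilation k c"
    using red unfolding reducible_to_dilation_def by blast
  have "A = (transvection i j (- a) ** transvection i j a) ** A"
    using transvection_inverse[OF ij, of "- a"] by simp
  also have "\<dots> = (transvection i j (- a) ** E) ** dilation k c"
    by (simp only: matrix_mul_assoc[symmetric] c)
  finally show ?thesis
    unfolding reducible_to_dilation_def using c elementary_group.step[OF ij] by blast
qed

text \<open>Elimination is run by contradiction: a counterexample stays one under every row operation, until
  it is a dilation. In this way \<open>elementary_group\<close> enters only through the two rules that generate
  it, rather than through closure under products and inverses.\<close>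

definition stuck :: "'k::division_ring ^ 'n ^ 'n \<Rightarrow> bool" where
  "stuck A \<longleftrightarrow> invertible A \<and> \<not> reducible_to_dilation A"

lemma stuck_transvection: "i \<noteq> j \<Longrightarrow> stuck A \<Longrightarrow> stuck (transvection i j a ** A)"
  using reducible_to_dilation_transvection[of i j a A]
    invertible_product[OF invertible_transvection[of i j a], of A]
  by (auto simp: stuck_def)

lemma stuck_add_row:
  assumes "k \<notin> C" "stuck A"
  shows "stuck (\<chi> i. if i \<in> C then A $ i + f i *s A $ k else A $ i)"
proof -
  have "finite C" by simp
  then show ?thesis using assms(1)
  proof (induction C)
    case empty
    then show ?case using assms(2) by (simp add: vec_nth_inverse)
  next
    case (insert c C)
    let ?A = "\<chi> i. if i \<in> C then A $ i + f i *s A $ k else A $ i"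
    have "transvection c k (f c) ** ?A
        = (\<chi> i. if i \<in> insert c C then A $ i + f i *s A $ k else A $ i)"
      using insert.prems insert.hyps by (subst vec_eq_iff) (auto simp: transvection_mult)
    moreover have "stuck (transvection c k (f c) ** ?A)"
      using insert by (intro stuck_transvection) auto
    ultimately show ?case by simp
  qed
qed

text \<open>The columns in \<open>S\<close> are already standard. If column \<open>k\<close> vanished outside the rows in \<open>S\<close>, it would
  be a right linear combination of them, and the vector \<open>w\<close> of this relation a nonzero element of
  the right kernel of \<open>A\<close>.\<close>

lemma ex_pivot:
  fixes A :: "'k::division_ring ^ 'n ^ 'n"
  assumes A: "invertible A" and std: "\<And>i j. j \<in> S \<Longrightarrow> A $ i $ j = (if i = j then 1 else 0)"
    and k: "k \<notin> S"
  shows "\<exists>r. r \<notin> S \<and> A $ r $ k \<noteq> 0"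
proof (rule ccontr)
  assume n: "\<not> ?thesis"
  define w where "w = (\<chi> l. (if l = k then 1 else 0) + (if l \<in> S then - A $ l $ k else 0))"
  have "(A *v w) $ i = 0" for i
  proof -
    have "(A *v w) $ i = (\<Sum>l\<in>UNIV. (if l = k then A $ i $ l else 0)
          + (if l = i then (if l \<in> S then - A $ l $ k else 0) else 0))"
      unfolding matrix_vector_mult_def w_def using std k by (simp, intro sum.cong) auto
    also have "\<dots> = A $ i $ k + (if i \<in> S then - A $ i $ k else 0)"
      by (simp add: sum.distrib)
    also have "\<dots> = 0" using n by auto
    finally show ?thesis .
  qed
  then have "A *v w = 0" by (simp add: vec_eq_iff)
  moreover obtain B where "B ** A = mat 1" using A unfolding invertible_def by blast
  then have "B *v (A *v w) = w" by (simp add: matrix_vector_mul_assoc)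
  ultimately have "w = 0" by (simp add: matrix_vector_mult_def vec_eq_iff)
  moreover have "w $ k = 1" using k by (simp add: w_def)
  ultimately show False by simp
qed

text \<open>Induction on the number of columns that are not yet standard. A pivot in the last of them can
  only be kept as it is, and becomes the coefficient of the dilation; any other pivot is turned
  into 1 with the help of a second row outside \<open>S\<close>. Rows outside \<open>S\<close> have zeros in the columns in
  \<open>S\<close>, so adding their multiples keeps these columns standard.\<close>

lemma not_stuck:
  fixes A :: "'k::division_ring ^ 'n ^ 'n"
  shows "(\<And>i j. j \<in> S \<Longrightarrow> A $ i $ j = (if i = j then 1 else 0)) \<Longrightarrow> \<not> stuck A"
proof (induction "card (UNIV - S)" arbitrary: S A rule: less_induct)
  case less
  note std = less.prems
  show ?case
  proof
    assume st: "stuck A"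
    have no_dil: False if "stuck (dilation k c)" "c \<noteq> 0" for k :: 'n and c :: 'k
    proof -
      have "dilation k c = mat 1 ** dilation k c" by simp
      then show False
        using that elementary_group.one unfolding stuck_def reducible_to_dilation_def by blast
    qed
    show False
    proof (cases "S = UNIV")
      case True
      then have "A = dilation undefined 1"
        using std by (simp add: vec_eq_iff dilation_def)
      then show False using no_dil st by (metis one_neq_zero)
    next
      case False
      then obtain k where k: "k \<notin> S" by blast
      have "invertible A" using st by (simp add: stuck_def)
      then have "\<exists>r. r \<notin> S \<and> A $ r $ k \<noteq> 0" using std k by (rule ex_pivot)
      then obtain r0 where r0: "r0 \<notin> S" "A $ r0 $ k \<noteq> 0" by blast
      show False
      proof (cases "UNIV - S = {k}")
        case True
        then have "r0 = k" using r0(1) by blast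
        define c where "c = A $ k $ k"
        then have c: "A $ k $ k = c" "c \<noteq> 0" using r0(2) \<open>r0 = k\<close> by simp_all
        let ?A = "\<chi> i. if i \<in> UNIV - {k} then A $ i + (- A $ i $ k * inverse c) *s A $ k else A $ i"
        have "A $ i $ j = (if i = j then 1 else 0)" if "j \<noteq> k" for i j
          using std[of j i] that True by blast
        then have "?A $ i $ j = dilation k c $ i $ j" for i j
          using c by (cases "j = k") (auto simp: dilation_def mult.assoc)
        then have "?A = dilation k c" by (simp only: vec_eq_iff) blast
        moreover have "stuck ?A" using st by (intro stuck_add_row) auto
        ultimately show False using no_dil c by metis
      next
        case False
        then obtain k' where k': "k' \<notin> S" "k' \<noteq> k" using k by blast
        obtain A0 :: "'k ^ 'n ^ 'n" and r where A0: "stuck A0" "r \<notin> S" "r \<noteq> k" "A0 $ r $ k \<noteq> 0"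
          and std0: "\<And>i j. j \<in> S \<Longrightarrow> A0 $ i $ j = (if i = j then 1 else 0)"
          \<comment> \<open>If the only pivot is in row \<open>k\<close> itself, it is first copied to another row outside \<open>S\<close>,
            so that entry \<open>(k, k)\<close> can be corrected to 1 by a transvection.\<close>
        proof (cases "\<exists>r. r \<notin> S \<and> r \<noteq> k \<and> A $ r $ k \<noteq> 0")
          case True
          then obtain r where "r \<notin> S" "r \<noteq> k" "A $ r $ k \<noteq> 0" by blast
          then show thesis using st std by (intro that[of A r])
        next
          case False
          then have "A $ k $ k \<noteq> 0" "A $ k' $ k = 0"
            using r0 k' by metis+
          moreover have "(transvection k' k 1 ** A) $ i $ j = (if i = j then 1 else 0)"
            if "j \<in> S" for i j
            using std[OF that] that k k'(2) by (auto simp: transvection_mult)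
          ultimately show thesis
            using st k' by (intro that[of "transvection k' k 1 ** A" k'])
              (simp_all add: transvection_mult stuck_transvection)
        qed
        define A1 where "A1 = transvection k r ((1 - A0 $ k $ k) * inverse (A0 $ r $ k)) ** A0"
        have A1: "stuck A1" "A1 $ k $ k = 1"
          using A0 by (auto simp: A1_def stuck_transvection transvection_mult mult.assoc)
        have std1: "A1 $ i $ j = (if i = j then 1 else 0)" if "j \<in> S" for i j
          using A0 std0[OF that] that k by (auto simp: A1_def transvection_mult)
        let ?A2 = "\<chi> i. if i \<in> UNIV - {k} then A1 $ i + (- A1 $ i $ k) *s A1 $ k else A1 $ i"
        have "stuck ?A2" using A1 by (intro stuck_add_row) auto
        moreover have "?A2 $ i $ j = (if i = j then 1 else 0)" if "j \<in> insert k S" for i j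
          using that A1(2) std1 k by auto
        moreover have "card (UNIV - insert k S) < card (UNIV - S)"
          using k by (intro psubset_card_mono) auto
        ultimately show False using less.hyps by blast
      qed
    qed
  qed
qed

lemma invertible_reducible_to_dilation: "invertible A \<Longrightarrow> reducible_to_dilation A"
  using not_stuck[of "{}" A] by (simp add: stuck_def)

section \<open>Covolume and linear maps\<close>

context discretely_valued
begin

definition image_under :: "('k ^ 'n ^ 'n) \<Rightarrow> ('k ^ 'n) set \<Rightarrow> ('k ^ 'n) set" where
  "image_under A M = (\<lambda>x. lincomb x A) ` M"

lemma image_under_mult: "image_under (A ** B) M = image_under B (image_under A M)"
  by (simp add: image_under_def image_image lincomb_lincomb)

lemma image_under_mat_1 [simp]: "image_under (mat 1) M = M"
  by (simp add: image_under_def lincomb_mat_1)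

lemma image_under_mono: "M \<subseteq> N \<Longrightarrow> image_under A M \<subseteq> image_under A N"
  by (auto simp: image_under_def)

lemma lattice_of_eq: "lattice_of v e = image_under e (cube 0)"
  unfolding lattice_of_def image_under_def cube_def by (auto simp: mem_valuation_ring)

lemma image_under_adjoin: "image_under A (adjoin M y) = adjoin (image_under A M) (lincomb y A)"
proof (rule equalityI; rule subsetI)
  fix z assume "z \<in> image_under A (adjoin M y)"
  then obtain u a where "z = lincomb (u + a *s y) A" "u \<in> M" "val_ge v 0 a"
    unfolding image_under_def by (auto elim: adjoinE)
  then show "z \<in> adjoin (image_under A M) (lincomb y A)"
    by (auto simp: lincomb_add lincomb_smult image_under_def intro!: adjoinI)
next
  fix z assume "z \<in> adjoin (image_under A M) (lincomb y A)"
  then obtain u a where "z = lincomb u A + a *s lincomb y A" "u \<in> M" "val_ge v 0 a"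
    unfolding image_under_def by (auto elim: adjoinE)
  then have "z = lincomb (u + a *s y) A" "u + a *s y \<in> adjoin M y"
    by (simp_all add: lincomb_add lincomb_smult adjoinI)
  then show "z \<in> image_under A (adjoin M y)" unfolding image_under_def by blast
qed

lemma lincomb_bounded:
  fixes A :: "'k ^ 'n ^ 'n"
  shows "\<exists>l. \<forall>m. \<forall>x\<in>cube m. lincomb x A \<in> cube (m + l)"
proof -
  define l where "l = Min ((\<lambda>(i, j). v (A $ i $ j)) ` UNIV)"
  have "l \<le> v (A $ i $ j)" for i j
    unfolding l_def by (rule Min_le) (auto intro!: image_eqI[of _ _ "(i, j)"])
  then have "val_ge v l (A $ i $ j)" for i j by (simp add: val_ge_def)
  then have "lincomb x A \<in> cube (m + l)" if "x \<in> cube m" for x m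
    using that by (auto simp: cube_def lincomb_nth intro!: val_ge_sum val_ge_mult)
  then show ?thesis by blast
qed

lemma full_module_image_under:
  fixes A :: "'k ^ 'n ^ 'n"
  assumes M: "full_module M" and A: "invertible A"
  shows "full_module (image_under A M)"
proof -
  obtain B where B: "B ** A = mat 1" using A unfolding invertible_def by blast
  obtain m k where mk: "cube m \<subseteq> M" "M \<subseteq> cube k" using M by (auto simp: full_module_def)
  obtain l where l: "\<And>m x. (x :: 'k ^ 'n) \<in> cube m \<Longrightarrow> lincomb x A \<in> cube (m + l)"
    using lincomb_bounded[of A] by blast
  obtain l' where l': "\<And>m x. (x :: 'k ^ 'n) \<in> cube m \<Longrightarrow> lincomb x B \<in> cube (m + l')"
    using lincomb_bounded[of B] by blast
  have "image_under A M \<subseteq> cube (k + l)" using l mk by (auto simp: image_under_def)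
  moreover have "cube (m - l') \<subseteq> image_under A M"
  proof
    fix x :: "'k ^ 'n" assume "x \<in> cube (m - l')"
    then have "lincomb x B \<in> M" using l'[of x "m - l'"] mk by auto
    moreover have "x = lincomb (lincomb x B) A" by (simp add: lincomb_lincomb B lincomb_mat_1)
    ultimately show "x \<in> image_under A M" unfolding image_under_def by blast
  qed
  moreover have "x + y \<in> image_under A M" if "x \<in> image_under A M" "y \<in> image_under A M" for x y
    using that full_module_add[OF M] by (auto simp: image_under_def lincomb_add[symmetric])
  moreover have "a *s x \<in> image_under A M" if "val_ge v 0 a" "x \<in> image_under A M" for x a
    using that full_module_smult[OF M] by (auto simp: image_under_def lincomb_smult[symmetric])
  ultimately show ?thesis
    unfolding full_module_def by (intro conjI ballI exI) (simp_all add: mem_valuation_ring)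
qed

lemma full_module_lattice_of: "invertible e \<Longrightarrow> full_module (lattice_of v e)"
  unfolding lattice_of_eq by (intro full_module_image_under full_module_cube)

text \<open>Leading valuations depend on the coordinate flag, but differences of covolumes do not: climbing from
  \<open>M\<close> to \<open>N\<close> by minimal extensions, they count the steps, and a linear automorphism maps minimal
  extensions to minimal extensions.\<close>

lemma covolume_diff_image_under:
  fixes A :: "'k ^ 'n::finite ^ 'n"
  assumes A: "invertible A" and N: "full_module N"
  shows "full_module M \<Longrightarrow> M \<subseteq> N \<Longrightarrow>
    covolume (image_under A M) - covolume (image_under A N) = covolume M - covolume N"
proof (induction "nat (covolume M - covolume N)" arbitrary: M rule: less_induct)
  case less
  note M = less.prems(1) and sub = less.prems(2)
  show ?case
  proof (cases "M = N")
    case False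
    obtain p where p: "p \<noteq> 0" "v p = 1" using ex_val by blast
    obtain y where y: "y \<in> N" "y \<notin> M" "p *s y \<in> M"
      using ex_minimal_extension[OF M N sub False p] by blast
    let ?M = "adjoin M y"
    have M': "full_module ?M" by (rule full_module_adjoin[OF M])
    have sub': "?M \<subseteq> N"
      using full_module_add[OF N] full_module_smult[OF N] y(1) sub by (auto elim!: adjoinE)
    have cov: "covolume ?M = covolume M - 1" by (rule covolume_adjoin[OF M y(2) p y(3)])
    have "covolume N \<le> covolume ?M" by (rule covolume_antimono[OF M' N sub'])
    then have IH: "covolume (image_under A ?M) - covolume (image_under A N) = covolume ?M - covolume N"
      using less.hyps[OF _ M' sub'] cov by simp
    obtain B where B: "A ** B = mat 1" using A unfolding invertible_def by blast
    have "lincomb y A \<notin> image_under A M"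
    proof
      assume "lincomb y A \<in> image_under A M"
      then obtain x where x: "x \<in> M" "lincomb y A = lincomb x A" unfolding image_under_def by blast
      then have "lincomb (lincomb y A) B = lincomb (lincomb x A) B" by simp
      then show False using x(1) y(2) by (simp add: lincomb_lincomb B lincomb_mat_1)
    qed
    moreover have "p *s lincomb y A \<in> image_under A M"
      using y(3) unfolding image_under_def lincomb_smult[symmetric] by blast
    ultimately have "covolume (image_under A ?M) = covolume (image_under A M) - 1"
      unfolding image_under_adjoin by (rule covolume_adjoin[OF full_module_image_under[OF M A] _ p])
    then show ?thesis using IH cov by simp
  qed simp
qed

lemma lead_val_cube_diag:
  assumes "\<And>i. d i \<noteq> 0"
  shows "lead_val (image_under (diag d) (cube 0)) i = v (d i)"
proof (rule lead_val_eqI)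
  have "axis i 1 \<in> cube 0" by (simp add: cube_def axis_def val_ge_def)
  then show "lincomb (axis i 1) (diag d) \<in> image_under (diag d) (cube 0)"
    unfolding image_under_def by blast
  show "leads i (lincomb (axis i 1) (diag d))"
    using assms by (auto simp: leads_def lincomb_diag axis_def)
  show "v (lincomb (axis i 1) (diag d) $ i) = v (d i)"
    by (simp add: lincomb_diag axis_def)
next
  fix x assume "x \<in> image_under (diag d) (cube 0)" "leads i x"
  then obtain y where "x $ i = y $ i * d i" "val_ge v 0 (y $ i)" "y $ i * d i \<noteq> 0"
    by (auto simp: image_under_def cube_def lincomb_diag leads_def)
  then show "v (d i) \<le> v (x $ i)" using assms[of i] by (auto simp: val_ge_def val_mult)
qed

lemma covolume_diag:
  "(\<And>i. d i \<noteq> 0) \<Longrightarrow> covolume (lattice_of v (diag d)) = (\<Sum>i\<in>UNIV. v (d i))"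
  by (simp add: covolume_def lattice_of_eq lead_val_cube_diag)

lemma covolume_cube_0: "covolume (cube 0 :: ('k ^ 'n::finite) set) = 0"
proof -
  have "diag (\<lambda>_. 1) = (mat 1 :: 'k ^ 'n ^ 'n)" by (simp add: diag_def mat_def)
  then show ?thesis using covolume_diag[of "\<lambda>_::'n. 1"] by (simp add: lattice_of_eq)
qed

lemma covolume_image_under:
  fixes A :: "'k ^ 'n::finite ^ 'n"
  assumes A: "invertible A" and M: "full_module M"
  shows "covolume (image_under A M) = covolume M + covolume (lattice_of v A)"
proof -
  obtain m where m: "cube m \<subseteq> M" using M by (auto simp: full_module_def)
  let ?C = "cube (max m 0) :: ('k ^ 'n) set"
  have C: "full_module ?C" by (rule full_module_cube)
  have "?C \<subseteq> M" using m cube_antimono[of m "max m 0"] by auto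
  then have "covolume (image_under A ?C) - covolume (image_under A M) = covolume ?C - covolume M"
    by (rule covolume_diff_image_under[OF A M C])
  moreover have "?C \<subseteq> cube 0" by (rule cube_antimono) simp
  then have "covolume (image_under A ?C) - covolume (image_under A (cube 0))
      = covolume ?C - covolume (cube 0 :: ('k ^ 'n) set)"
    by (rule covolume_diff_image_under[OF A full_module_cube C])
  ultimately show ?thesis unfolding lattice_of_eq covolume_cube_0 by linarith
qed

lemma covolume_lattice_of_mult:
  "invertible A \<Longrightarrow> invertible B \<Longrightarrow>
    covolume (lattice_of v (A ** B)) = covolume (lattice_of v A) + covolume (lattice_of v B)"
  using covolume_image_under[of B "lattice_of v A"] full_module_lattice_of[of A]
  by (simp add: lattice_of_eq image_under_mult)

section \<open>The valuation of the Dieudonne determinant\<close>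

lemma image_under_integral:
  fixes A :: "'k ^ 'n ^ 'n"
  assumes "\<And>i j. val_ge v 0 (A $ i $ j)"
  shows "image_under A (cube 0) \<subseteq> cube 0"
proof
  fix x assume "x \<in> image_under A (cube 0)"
  then obtain y where y: "x = lincomb y A" "y \<in> cube 0" unfolding image_under_def by blast
  have "val_ge v (0 + 0) (y $ i * A $ i $ j)" for i j
    using y(2) assms by (intro val_ge_mult) (auto simp: cube_def)
  then show "x \<in> cube 0" by (auto simp: y cube_def lincomb_nth intro!: val_ge_sum)
qed

text \<open>An integral transvection preserves \<open>\<O>\<^sup>n\<close>, and every transvection is conjugate to an integral
  one by a diagonal matrix.\<close>

lemma covolume_transvection:
  fixes i j :: "'n::finite"
  assumes ij: "i \<noteq> j"
  shows "covolume (lattice_of v (transvection i j a)) = 0"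
proof -
  have integral: "covolume (lattice_of v (transvection i j b)) = 0" if b: "val_ge v 0 b" for b
  proof -
    have "val_ge v 0 (- b)" using b by (simp add: val_ge_def)
    then have le: "image_under (transvection i j b) (cube 0) \<subseteq> cube 0"
      "image_under (transvection i j (- b)) (cube 0) \<subseteq> cube 0"
      using b by (auto intro!: image_under_integral simp: transvection_def val_ge_def)
    have "image_under (transvection i j (- b) ** transvection i j b) (cube 0)
        \<subseteq> image_under (transvection i j b) (cube 0)"
      unfolding image_under_mult by (rule image_under_mono[OF le(2)])
    then have "cube 0 \<subseteq> image_under (transvection i j b) (cube 0)"
      using transvection_inverse[OF ij, of "- b"] by simp
    then show ?thesis using le(1) covolume_cube_0 by (simp add: lattice_of_eq subset_antisym)
  qed
  show ?thesis
  proof (cases "a = 0")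
    case False
    obtain s where s: "s \<noteq> 0" "v s = - v a" using ex_val by blast
    let ?D = "diag (\<lambda>k. if k = i then s else 1) :: 'k ^ 'n ^ 'n"
    have D: "invertible ?D" using s by (intro invertible_diag) simp
    have "(?D ** transvection i j a) $ k = (transvection i j (s * a) ** ?D) $ k" for k
      using ij by (simp add: diag_mult transvection_mult)
        (auto simp: vec_eq_iff transvection_def diag_def)
    then have "?D ** transvection i j a = transvection i j (s * a) ** ?D" by (simp add: vec_eq_iff)
    then have "covolume (lattice_of v (transvection i j a))
        = covolume (lattice_of v (transvection i j (s * a)))"
      using covolume_lattice_of_mult[OF D invertible_transvection[OF ij, of a]]
        covolume_lattice_of_mult[OF invertible_transvection[OF ij, of "s * a"] D] by simp
    then show ?thesis using integral[of "s * a"] False s by (simp add: val_ge_def val_mult)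
  qed (simp add: integral)
qed

lemma covolume_elementary: "E \<in> elementary_group \<Longrightarrow> covolume (lattice_of v E) = 0"
proof (induction rule: elementary_group.induct)
  case one
  then show ?case by (simp add: lattice_of_eq covolume_cube_0)
next
  case (step i j E a)
  then show ?case
    by (simp add: covolume_lattice_of_mult invertible_transvection invertible_elementary
        covolume_transvection)
qed

lemma covolume_elementary_dilation:
  assumes "E \<in> elementary_group" "c \<noteq> 0"
  shows "covolume (lattice_of v (E ** dilation i c)) = v c"
proof -
  have "covolume (lattice_of v (dilation i c)) = (\<Sum>k\<in>UNIV. v (if k = i then c else 1))"
    unfolding dilation_eq_diag using assms(2) by (intro covolume_diag) simp
  also have "\<dots> = v c" by (simp add: if_distrib[of v] cong: if_cong)
  finally show ?thesis
    using assms by (simp add: covolume_lattice_of_mult covolume_elementary invertible_elementary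
        dilation_eq_diag invertible_diag)
qed

lemma group_mult_group: "group (mult_group :: 'k monoid)"
proof (rule groupI)
  fix x :: 'k assume "x \<in> carrier mult_group"
  then show "\<exists>y\<in>carrier mult_group. y \<otimes>\<^bsub>mult_group\<^esub> x = \<one>\<^bsub>mult_group\<^esub>"
    by (intro bexI[of _ "inverse x"]) (auto simp: mult_group_def)
qed (auto simp: mult_group_def mult.assoc)

lemma commutator_val:
  assumes "h \<in> derived mult_group (carrier mult_group)"
  shows "h \<noteq> 0 \<and> v h = 0"
proof -
  have m_inv: "inv\<^bsub>mult_group\<^esub> x = inverse x" if "x \<noteq> 0" for x :: 'k
    using that group.inv_equality[OF group_mult_group, of "inverse x" x] by (simp add: mult_group_def)
  have com: "h \<noteq> 0 \<and> v h = 0" if "h \<in> derived_set mult_group (carrier mult_group)" for h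
    using that by (auto simp: mult_group_def m_inv[unfolded mult_group_def] val_mult val_inverse)
  show ?thesis
    using assms unfolding derived_def
  proof (induction rule: generate.induct)
    case one
    then show ?case by (simp add: mult_group_def)
  next
    case (incl h)
    then show ?case by (rule com)
  next
    case (inv h)
    then have "h \<noteq> 0 \<and> v h = 0" by (rule com)
    then show ?case by (simp add: val_inverse m_inv)
  next
    case (eng h1 h2)
    then show ?case by (simp add: mult_group_def val_mult)
  qed
qed

text \<open>The covolume of the row lattice depends on \<open>A\<close> alone, while any decomposition
  \<open>A = E ** dilation i c\<close> computes it as \<open>v c\<close>: hence \<open>v c\<close> is the same for all of them, in
  particular for the one selected by the choice operator.\<close>

lemma class_val_dieudonne_det:
  assumes "invertible A"
  shows "class_val v (dieudonne_det A) = covolume (lattice_of v A)"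
proof -
  define c where "c = (SOME c. c \<noteq> 0 \<and> (\<exists>E\<in>elementary_group. \<exists>i. A = E ** dilation i c))"
  have "\<exists>c. c \<noteq> 0 \<and> (\<exists>E\<in>elementary_group. \<exists>i. A = E ** dilation i c)"
    using invertible_reducible_to_dilation[OF assms] unfolding reducible_to_dilation_def .
  then have c: "c \<noteq> 0 \<and> (\<exists>E\<in>elementary_group. \<exists>i. A = E ** dilation i c)"
    unfolding c_def by (rule someI_ex)
  then have cov: "covolume (lattice_of v A) = v c" using covolume_elementary_dilation by blast
  let ?H = "derived mult_group (carrier mult_group) :: 'k set"
  have "1 \<in> ?H" unfolding derived_def using generate.one[of mult_group] by (simp add: mult_group_def)
  moreover have "v (h * c) = v c" if "h \<in> ?H" for h
    using commutator_val[OF that] c by (simp add: val_mult)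
  moreover have "dieudonne_det A = (\<lambda>h. h * c) ` ?H"
    unfolding dieudonne_det_def c_def[symmetric] by (auto simp: r_coset_def mult_group_def)
  ultimately have "v ` dieudonne_det A = {v c}" by (auto simp: image_image)
  then show ?thesis unfolding class_val_def cov by simp
qed

end

section \<open>Lattices, homothety and type\<close>

context discretely_valued
begin

lemma is_lattice_iff: "is_lattice v L \<longleftrightarrow> (\<exists>e. invertible e \<and> L = lattice_of v e)"
  by (simp add: is_lattice_def is_basis_iff_invertible)

lemma is_lattice_full_module: "is_lattice v L \<Longrightarrow> full_module L"
  by (auto simp: is_lattice_iff full_module_lattice_of)

lemma image_under_diag_cube:
  fixes d :: "'n::finite \<Rightarrow> 'k"
  assumes "\<And>i. d i \<noteq> 0"
  shows "image_under (diag d) (cube 0) = {x. \<forall>i. val_ge v (v (d i)) (x $ i)}"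
proof (rule equalityI; rule subsetI)
  fix x assume "x \<in> image_under (diag d) (cube 0)"
  then obtain y where y: "x = lincomb y (diag d)" "y \<in> cube 0" unfolding image_under_def by blast
  have "val_ge v (0 + v (d i)) (y $ i * d i)" for i
    using y(2) by (intro val_ge_mult) (auto simp: cube_def val_ge_def)
  then show "x \<in> {x. \<forall>i. val_ge v (v (d i)) (x $ i)}" by (simp add: y lincomb_diag)
next
  fix x :: "'k ^ 'n" assume x: "x \<in> {x. \<forall>i. val_ge v (v (d i)) (x $ i)}"
  define y where "y = (\<chi> i. x $ i * inverse (d i))"
  have "val_ge v (v (d i) + - v (d i)) (x $ i * inverse (d i))" for i
    using x assms by (intro val_ge_mult) (auto simp: val_ge_def val_inverse)
  then have "y \<in> cube 0" by (simp add: cube_def y_def)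
  moreover have "x = lincomb y (diag d)"
    using assms by (simp add: vec_eq_iff lincomb_diag y_def mult.assoc)
  ultimately show "x \<in> image_under (diag d) (cube 0)" unfolding image_under_def by blast
qed

text \<open>Since \<open>\<O>\<close> is stable under conjugation, multiplying a lattice by a scalar on the left has the
  same effect as multiplying each vector of a basis by it; in particular only the valuation of the
  scalar matters.\<close>

lemma scale_set_lattice_of:
  fixes e :: "'k ^ 'n ^ 'n"
  assumes a: "a \<noteq> 0"
  shows "scale_set a (lattice_of v e) = image_under e (cube (v a))"
    and "scale_set a (lattice_of v e) = lattice_of v (diag (\<lambda>_. a) ** e)"
proof -
  have "scale_set a (cube 0) = (cube (v a) :: ('k ^ 'n) set)"
  proof (rule equalityI; rule subsetI)
    fix x :: "'k ^ 'n" assume "x \<in> scale_set a (cube 0)"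
    then obtain y where y: "x = a *s y" "y \<in> cube 0" unfolding scale_set_def by blast
    have "val_ge v (v a + 0) (a * y $ i)" for i
      using y(2) by (intro val_ge_mult) (auto simp: cube_def val_ge_def)
    then show "x \<in> cube (v a)" by (simp add: y cube_def)
  next
    fix x :: "'k ^ 'n" assume x: "x \<in> cube (v a)"
    have "val_ge v (- v a + v a) (inverse a * x $ i)" for i
      using x a by (intro val_ge_mult) (auto simp: cube_def val_ge_def val_inverse)
    then have "inverse a *s x \<in> cube 0" by (simp add: cube_def)
    moreover have "x = a *s (inverse a *s x)" using a by (simp add: vector_smult_assoc)
    ultimately show "x \<in> scale_set a (cube 0)" unfolding scale_set_def by blast
  qed
  moreover have "scale_set a (image_under e C) = image_under e (scale_set a C)" for C
    by (simp add: scale_set_def image_under_def image_image lincomb_smult)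
  ultimately show 1: "scale_set a (lattice_of v e) = image_under e (cube (v a))"
    by (simp add: lattice_of_eq)
  have "image_under (diag (\<lambda>_. a)) (cube 0) = (cube (v a) :: ('k ^ 'n) set)"
    using a image_under_diag_cube[of "\<lambda>_::'n. a"] by (simp add: cube_def[of "v a"])
  then show "scale_set a (lattice_of v e) = lattice_of v (diag (\<lambda>_. a) ** e)"
    unfolding 1 by (simp add: lattice_of_eq image_under_mult)
qed

lemma is_lattice_scale_set: "is_lattice v L \<Longrightarrow> a \<noteq> 0 \<Longrightarrow> is_lattice v (scale_set a L)"
  unfolding is_lattice_iff
  by (metis scale_set_lattice_of(2) invertible_product invertible_diag)

lemma scale_set_cong:
  "is_lattice v L \<Longrightarrow> a \<noteq> 0 \<Longrightarrow> b \<noteq> 0 \<Longrightarrow> v a = v b \<Longrightarrow> scale_set a L = scale_set b L"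
  unfolding is_lattice_iff by (metis scale_set_lattice_of(1))

lemma covolume_scale_set:
  fixes L :: "('k ^ 'n) set"
  assumes "is_lattice v L" "a \<noteq> 0"
  shows "covolume (scale_set a L) = covolume L + int CARD('n) * v a"
proof -
  obtain e where e: "invertible e" "L = lattice_of v e" using assms(1) is_lattice_iff by blast
  have "invertible (diag (\<lambda>_. a) :: 'k ^ 'n ^ 'n)" using assms(2) by (simp add: invertible_diag)
  then show ?thesis
    using e assms(2) covolume_diag[of "\<lambda>_::'n. a"]
    by (simp add: scale_set_lattice_of(2) covolume_lattice_of_mult)
qed

lemma scale_set_scale_set: "scale_set a (scale_set b L) = scale_set (a * b) L"
  by (simp add: scale_set_def image_image vector_smult_assoc)

lemma scale_set_1 [simp]: "scale_set 1 L = (L :: ('k ^ 'n) set)"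
  by (simp add: scale_set_def)

lemma scale_set_subset_iff:
  assumes "a \<noteq> (0::'k)"
  shows "scale_set a L \<subseteq> scale_set a M \<longleftrightarrow> L \<subseteq> (M :: ('k ^ 'n) set)"
proof
  assume "scale_set a L \<subseteq> scale_set a M"
  then have "scale_set (inverse a) (scale_set a L) \<subseteq> scale_set (inverse a) (scale_set a M)"
    unfolding scale_set_def[of "inverse a"] by (rule image_mono)
  then show "L \<subseteq> M" using assms by (simp add: scale_set_scale_set)
qed (auto simp: scale_set_def)

lemma mem_homothety_class: "L \<in> homothety_class (L :: ('k ^ 'n) set)"
  unfolding homothety_class_def using scale_set_1[of L] by (metis (mono_tags, lifting) mem_Collect_eq one_neq_zero)

lemma homothety_class_scale_set:
  fixes L :: "('k ^ 'n) set"
  assumes a: "a \<noteq> 0"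
  shows "homothety_class (scale_set a L) = homothety_class L"
proof (rule equalityI; rule subsetI)
  fix M assume "M \<in> homothety_class (scale_set a L)"
  then obtain b where "M = scale_set (b * a) L" "b \<noteq> 0"
    by (auto simp: homothety_class_def scale_set_scale_set)
  moreover from this a have "b * a \<noteq> 0" by simp
  ultimately show "M \<in> homothety_class L" unfolding homothety_class_def by blast
next
  fix M assume "M \<in> homothety_class L"
  then obtain b where b: "M = scale_set b L" "b \<noteq> 0" unfolding homothety_class_def by blast
  then have "M = scale_set (b * inverse a) (scale_set a L)"
    using a by (simp add: scale_set_scale_set mult.assoc)
  moreover have "b * inverse a \<noteq> 0" using a b by simp
  ultimately show "M \<in> homothety_class (scale_set a L)" unfolding homothety_class_def by blast
qed

lemma homothety_class_eqD:
  fixes L :: "('k ^ 'n) set"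
  assumes "homothety_class L = homothety_class M"
  shows "\<exists>a. a \<noteq> 0 \<and> M = scale_set a L"
  using mem_homothety_class[of M] assms[symmetric] unfolding homothety_class_def by auto

lemma vertex_type_homothety_class:
  fixes L :: "('k ^ 'n) set"
  assumes L: "is_lattice v L"
  shows "vertex_type v (homothety_class L) = covolume L mod int CARD('n)"
  unfolding vertex_type_def
proof (rule the_equality)
  obtain e where "invertible e" "L = lattice_of v e" using L is_lattice_iff by blast
  then show "\<exists>e :: 'k ^ 'n ^ 'n. is_basis e \<and> homothety_class L = homothety_class (lattice_of v e) \<and>
      covolume L mod int CARD('n) = class_val v (dieudonne_det e) mod int CARD('n)"
    by (auto simp: is_basis_iff_invertible class_val_dieudonne_det)
next
  fix t
  assume "\<exists>e :: 'k ^ 'n ^ 'n. is_basis e \<and> homothety_class L = homothety_class (lattice_of v e) \<and>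
      t = class_val v (dieudonne_det e) mod int CARD('n)"
  then obtain e :: "'k ^ 'n ^ 'n" where e: "invertible e"
    "homothety_class L = homothety_class (lattice_of v e)"
    "t = covolume (lattice_of v e) mod int CARD('n)"
    by (auto simp: is_basis_iff_invertible class_val_dieudonne_det)
  obtain a where "a \<noteq> 0" "lattice_of v e = scale_set a L"
    using homothety_class_eqD[OF e(2)] by blast
  then show "t = covolume L mod int CARD('n)" using e(3) L by (simp add: covolume_scale_set)
qed

section \<open>Prints\<close>

lemma graph_dist_le_1_iff: "graph_dist v x y \<le> enat 1 \<longleftrightarrow> x = y \<or> adjacent v x y"
proof
  assume le: "graph_dist v x y \<le> enat 1"
  show "x = y \<or> adjacent v x y"
  proof (rule ccontr)
    assume n: "\<not> (x = y \<or> adjacent v x y)"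
    have "enat 2 \<le> graph_dist v x y"
      unfolding graph_dist_def
    proof (rule INF_greatest)
      fix k assume "k \<in> {k. (adjacent v ^^ k) x y}"
      then have k: "(adjacent v ^^ k) x y" by simp
      have "k \<noteq> 0" "k \<noteq> 1" using k n by (auto simp: relcompp_apply)
      then show "enat 2 \<le> enat k" by simp
    qed
    then have "enat 2 \<le> enat 1" using le by (rule order_trans)
    then show False by simp
  qed
next
  assume "x = y \<or> adjacent v x y"
  then have "\<exists>k. (adjacent v ^^ k) x y \<and> k \<le> 1"
  proof
    assume "x = y"
    then show ?thesis by (intro exI[of _ 0]) simp
  next
    assume "adjacent v x y"
    then show ?thesis by (intro exI[of _ 1]) (simp add: relcompp_apply)
  qed
  then obtain k where "(adjacent v ^^ k) x y" "k \<le> 1" by blast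
  then show "graph_dist v x y \<le> enat 1"
    unfolding graph_dist_def by (intro INF_lower2[of k]) auto
qed

lemma mem_vertex_print_iff:
  "y \<in> vertex_print v x \<longleftrightarrow> y \<in> vertices v \<and> vertex_type v y = 0 \<and> (x = y \<or> adjacent v x y)"
  unfolding vertex_print_def vertex_ball_def by (simp only: graph_dist_le_1_iff Int_iff mem_Collect_eq) blast

text \<open>The range is chosen such that the covolume can be brought up to 0 by multiplying fewer than \<open>n\<close>
  vectors of a basis by \<open>\<pi>\<close>.\<close>

lemma ex_normalized_representative:
  fixes x :: "('k ^ 'n) set set"
  assumes "x \<in> vertices v"
  shows "\<exists>L. is_lattice v L \<and> x = homothety_class L \<and> - int CARD('n) < covolume L \<and> covolume L \<le> 0"
proof -
  obtain L where L: "is_lattice v L" "x = homothety_class L"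
    using assms unfolding vertices_def by blast
  let ?n = "int CARD('n)"
  obtain a where a: "a \<noteq> 0" "v a = - covolume L div ?n" using ex_val by blast
  have "covolume (scale_set a L) = - (- covolume L mod ?n)"
    using L a by (simp add: covolume_scale_set minus_div_mult_eq_mod[symmetric] algebra_simps)
  moreover have "0 \<le> - covolume L mod ?n" "- covolume L mod ?n < ?n" by simp_all
  ultimately have "- ?n < covolume (scale_set a L)" "covolume (scale_set a L) \<le> 0" by linarith+
  then show ?thesis
    using is_lattice_scale_set[OF L(1) a(1)] L(2) homothety_class_scale_set[OF a(1)] by metis
qed

text \<open>Adjacency speaks of arbitrary representatives \<open>aL\<close> and \<open>bM\<close>. Comparing covolumes in
  \<open>\<pi>aL \<subseteq> bM \<subseteq> aL\<close> shows that \<open>v(b)\<close> is \<open>v(a)\<close> or \<open>v(a) + 1\<close>. In the first case \<open>a\<close> and \<open>b\<close> may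
  be cancelled, and the second case is degenerate.\<close>

lemma print_lattice_subset:
  fixes L M :: "('k ^ 'n) set"
  assumes L: "is_lattice v L" and norm: "- int CARD('n) < covolume L" "covolume L \<le> 0"
    and M: "is_lattice v M" and M0: "covolume M = 0"
    and pr: "homothety_class M \<in> vertex_print v (homothety_class L)"
  shows "M \<subseteq> L"
proof (cases "homothety_class L = homothety_class M")
  let ?n = "int CARD('n)"
  case True
  then obtain a where a: "a \<noteq> 0" "M = scale_set a L" using homothety_class_eqD by blast
  then have "covolume L = - (?n * v a)" using M0 L by (simp add: covolume_scale_set)
  then have "?n * v a < ?n * 1" "?n * 0 \<le> ?n * v a" using norm by linarith+
  then have "v a < 1" "0 \<le> v a"
    by (simp_all only: mult_less_cancel_left_pos mult_le_cancel_left_pos of_nat_0_less_iff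
        zero_less_card_finite)
  then have "v a = 0" by simp
  then show ?thesis using a scale_set_cong[OF L a(1), of 1] by simp
next
  case False
  let ?n = "int CARD('n)"
  have n: "?n > 0" by simp
  obtain p a b where p: "uniformizer v p" and ab: "a \<noteq> 0" "b \<noteq> 0"
    and sub: "scale_set p (scale_set a L) \<subseteq> scale_set b M" "scale_set b M \<subseteq> scale_set a L"
    using pr False unfolding mem_vertex_print_iff adjacent_def homothety_class_def by blast
  have p: "p \<noteq> 0" "v p = 1" using p by (auto simp: uniformizer_iff)
  note lat = is_lattice_scale_set[OF L ab(1)] is_lattice_scale_set[OF M ab(2)]
    is_lattice_scale_set[OF is_lattice_scale_set[OF L ab(1)] p(1)]
  note full = lat[THEN is_lattice_full_module]
  have covs: "covolume (scale_set a L) = covolume L + ?n * v a" "covolume (scale_set b M) = ?n * v b"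
    "covolume (scale_set p (scale_set a L)) = covolume L + ?n * v a + ?n"
    using L M M0 lat p ab by (simp_all add: covolume_scale_set)
  have "covolume L \<le> ?n * (v b - v a)" "?n * (v b - v a) \<le> covolume L + ?n"
    using covolume_antimono[OF full(2,1) sub(2)] covolume_antimono[OF full(3,2) sub(1)] covs
    by (simp_all add: algebra_simps)
  then have "?n * - 1 < ?n * (v b - v a)" "?n * (v b - v a) \<le> ?n * 1" using norm by linarith+
  then have "- 1 < v b - v a" "v b - v a \<le> 1"
    using n by (simp_all only: mult_less_cancel_left_pos mult_le_cancel_left_pos)
  then consider "v b = v a" | "v b = v a + 1" by linarith
  then show ?thesis
  proof cases
    case 1
    then have "scale_set b M = scale_set a M" using scale_set_cong[OF M ab(2,1)] by simp
    then show ?thesis using sub(2) scale_set_subset_iff[OF ab(1), of M L] by simp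
  next
    case 2
    \<comment> \<open>This forces \<open>covolume L = 0\<close>, and \<open>M\<close> is homothetic to \<open>L\<close> by strict monotonicity.\<close>
    have "covolume (scale_set b M) \<le> covolume (scale_set p (scale_set a L))"
      by (rule covolume_antimono[OF full(3,2) sub(1)])
    moreover have "covolume (scale_set p (scale_set a L)) \<le> covolume (scale_set b M)"
      using covs 2 norm by (simp add: algebra_simps)
    ultimately have "scale_set p (scale_set a L) = scale_set b M"
      by (intro covolume_eq_imp_eq[OF full(3,2) sub(1)]) simp
    moreover have "scale_set (p * a) L = scale_set b L"
      using p ab 2 by (intro scale_set_cong[OF L]) (auto simp: val_mult)
    ultimately have "scale_set b M = scale_set b L" by (simp add: scale_set_scale_set)
    then show ?thesis using scale_set_subset_iff[OF ab(2), of M L] by simp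
  qed
qed

text \<open>For \<open>L\<close> with basis \<open>e\<close>, multiplying \<open>- covolume L\<close> of the vectors \<open>e\<^sub>k\<close> by \<open>\<pi>\<close> gives a lattice of
  the print. As fewer than \<open>n\<close> vectors are multiplied, any given \<open>e\<^sub>i\<close> can be spared.\<close>

lemma ex_print_lattice_containing:
  fixes e :: "'k ^ 'n ^ 'n"
  assumes e: "invertible e"
    and norm: "- int CARD('n) < covolume (lattice_of v e)" "covolume (lattice_of v e) \<le> 0"
  shows "\<exists>M. is_lattice v M \<and> covolume M = 0 \<and> e $ i \<in> M \<and>
    homothety_class M \<in> vertex_print v (homothety_class (lattice_of v e))"
proof -
  let ?L = "lattice_of v e"
  have L: "is_lattice v ?L" using e is_lattice_iff by blast
  obtain p where p: "p \<noteq> 0" "v p = 1" using ex_val by blast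
  have "nat (- covolume ?L) \<le> card (UNIV - {i})" using norm by (simp add: card_Diff_singleton)
  then obtain I where I: "I \<subseteq> UNIV - {i}" "card I = nat (- covolume ?L)"
    using obtain_subset_with_card_n by metis
  define d where "d = (\<lambda>k. if k \<in> I then p else 1)"
  have d: "d k \<noteq> 0" "0 \<le> v (d k)" "v (d k) \<le> 1" for k using p by (auto simp: d_def)
  let ?M = "lattice_of v (diag d ** e)"
  have inv: "invertible (diag d)" using d(1) by (rule invertible_diag)
  have M: "is_lattice v ?M" using invertible_product[OF inv e] is_lattice_iff by blast
  have "(\<Sum>k\<in>UNIV. v (d k)) = int (card I)"
    using p by (simp add: d_def if_distrib[of v] sum.If_cases)
  then have M0: "covolume ?M = 0"
    using norm(2) I(2) by (simp add: covolume_lattice_of_mult[OF inv e] covolume_diag d(1))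
  have D: "image_under (diag d) (cube 0) = {x. \<forall>k. val_ge v (v (d k)) (x $ k)}"
    using d(1) by (rule image_under_diag_cube)
  have eq: "?M = image_under e (image_under (diag d) (cube 0))"
    by (simp add: lattice_of_eq image_under_mult)
  have D_sub: "image_under (diag d) (cube 0) \<subseteq> cube 0" "cube 1 \<subseteq> image_under (diag d) (cube 0)"
    unfolding D unfolding cube_def using val_ge_mono[OF _ d(2)] val_ge_mono[OF _ d(3)] by blast+
  have sub: "?M \<subseteq> ?L" "scale_set p ?L \<subseteq> ?M"
    using D_sub[THEN image_under_mono, of e]
    by (simp_all only: eq lattice_of_eq[of e, symmetric] scale_set_lattice_of(1)[OF p(1)] p(2))
  have "axis i 1 \<in> image_under (diag d) (cube 0)"
    unfolding D using I(1) by (auto simp: axis_def val_ge_def d_def)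
  then have "e $ i \<in> ?M" unfolding eq image_under_def[of e] using lincomb_axis[of i e] by force
  moreover have "homothety_class ?M \<in> vertex_print v (homothety_class ?L)"
  proof -
    have "homothety_class ?M \<in> vertices v" "homothety_class ?L \<in> vertices v"
      using M L unfolding vertices_def by blast+
    moreover have "vertex_type v (homothety_class ?M) = 0"
      using M0 by (simp add: vertex_type_homothety_class[OF M])
    moreover have "uniformizer v p" using p by (simp add: uniformizer_iff)
    then have "\<exists>p L1 L2. uniformizer v p \<and> L1 \<in> homothety_class ?L \<and> L2 \<in> homothety_class ?M \<and>
        scale_set p L1 \<subseteq> L2 \<and> L2 \<subseteq> L1"
      using sub mem_homothety_class by blast
    ultimately show ?thesis unfolding mem_vertex_print_iff adjacent_def by blast
  qed
  ultimately show ?thesis using M M0 by blast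
qed

lemma vertex_print_mono_imp_subset:
  fixes L1 L2 :: "('k ^ 'n) set"
  assumes L1: "is_lattice v L1" "- int CARD('n) < covolume L1" "covolume L1 \<le> 0"
    and L2: "is_lattice v L2" "- int CARD('n) < covolume L2" "covolume L2 \<le> 0"
    and sub: "vertex_print v (homothety_class L1) \<subseteq> vertex_print v (homothety_class L2)"
  shows "L1 \<subseteq> L2"
proof
  obtain e where e: "invertible e" "L1 = lattice_of v e" using L1(1) is_lattice_iff by blast
  have L2': "full_module L2" by (rule is_lattice_full_module[OF L2(1)])
  have mem: "e $ i \<in> L2" for i
  proof -
    obtain M where M: "is_lattice v M" "covolume M = 0" "e $ i \<in> M"
      "homothety_class M \<in> vertex_print v (homothety_class L1)"
      using ex_print_lattice_containing[OF e(1)] L1 e(2) by blast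
    then have "homothety_class M \<in> vertex_print v (homothety_class L2)" using sub by blast
    then have "M \<subseteq> L2" by (rule print_lattice_subset[OF L2 M(1,2)])
    then show ?thesis using M(3) by blast
  qed
  fix x assume "x \<in> L1"
  then obtain a where "x = lincomb a e" "\<And>i. val_ge v 0 (a $ i)"
    unfolding e lattice_of_def by (auto simp: mem_valuation_ring)
  then show "x \<in> L2"
    unfolding lincomb_def by (auto intro!: full_module_sum[OF L2'] full_module_smult[OF L2'] mem)
qed

end

theorem proposition3p6:
  fixes v :: "'k::division_ring \<Rightarrow> int"
    and x1 x2 :: "('k ^ 'n) set set"
  assumes "CARD('n) \<ge> 4"
    and "local_skew_field v"
    and "CHAR('k) = 0"
    and "x1 \<in> vertices v" and "x2 \<in> vertices v"
    and "vertex_print v x1 = vertex_print v x2"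
  shows "x1 = x2"
proof -
  interpret discretely_valued v
    using assms(2) by unfold_locales (simp add: local_skew_field_def)
  obtain L1 where L1: "is_lattice v L1" "x1 = homothety_class L1"
    "- int CARD('n) < covolume L1" "covolume L1 \<le> 0"
    using ex_normalized_representative[OF assms(4)] by blast
  obtain L2 where L2: "is_lattice v L2" "x2 = homothety_class L2"
    "- int CARD('n) < covolume L2" "covolume L2 \<le> 0"
    using ex_normalized_representative[OF assms(5)] by blast
  have "L1 \<subseteq> L2" "L2 \<subseteq> L1"
    using vertex_print_mono_imp_subset[OF L1(1,3,4) L2(1,3,4)]
      vertex_print_mono_imp_subset[OF L2(1,3,4) L1(1,3,4)] assms(6) L1(2) L2(2) by simp_all
  then show ?thesis using L1(2) L2(2) by simp
qed

end
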